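(* Let $d>1$ be an integer, $\mathbb{O}_d=(\mathbb{R}_+)^d$, $F,G:\mathbb{O}_d\times\mathbb{R}^d\to\mathbb{R}^d$, $r>0$, $\lambda>0$ and $T\in\mathcal{L}(\mathbb{R}^d)$. Assume: (i) for every $x\in\mathbb{O}_d$, $p\in\mathbb{R}^d$ and $i\in\{1,\dots,d\}$, $x^i=0$ implies $F^i(x,p)\le 0$; moreover $T(\mathbb{O}_d)\subset\mathbb{O}_d$; (ii) there exists $R_*>0$ such that $\sum_{i=1}^d F^i(x,p)\ge 0$ for all $x\in\mathbb{O}_d$ with $|x|_1\ge R_*$ and all $p\in\mathbb{R}^d$; moreover $T(B^1_{R_*})\subset B^1_{R_*}$; (iii) $(G,F)$ is monotone, i.e. $\langle G(x,p)-G(y,q),x-y\rangle+\langle F(x,p)-F(y,q),p-q\rangle\ge 0$ for all $x,y\in\mathbb{O}_d$, $p,q\in\mathbb{R}^d$. Then there exists at most one monotone solution $U:\mathbb{O}_d\to\mathbb{R}^d$ of the (stationary) master equation for the mean field game of optimal stopping.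
   Context: Notation: $|x|_1=x_1+\dots+x_d$ for $x\in\mathbb{O}_d$; $B^1_R=\{x\in\mathbb{O}_d:\ x_1+\dots+x_d\le R\}$; $T^*$ is the adjoint of $T$; $\langle\cdot,\cdot\rangle$ is the Euclidean scalar product. For a vector $x$, $x\le 0$ means that all components of $x$ are $\le0$. Definition (monotone solution for optimal stopping). $U\in\mathcal{C}(\mathbb{O}_d,\mathbb{R}^d)$ is a monotone solution of the master equation for the mean field game of optimal stopping if (1) $U(x)\le0$ for all $x\in\mathbb{O}_d$; (2) for any $V\in\mathbb{R}^d$ with $V\le0$, any $y\in\mathbb{O}_d$, any sufficiently large $R>0$ (i.e. any $R\ge R_0$ for some $R_0>0$ independent of $V,y$), and any point $x_0\in B_R^1$ of strict minimum on $B^1_R$ of $x\mapsto\langle U(x)-V,x-y\rangle$ (the minimum over $B^1_R$ is attained at $x_0$ and only there), $$r\langle U(x_0),x_0-y\rangle+\lambda\langle U(x_0)-T^*U(Tx_0),x_0-y\rangle\ \ge\ \langle G(x_0,U(x_0)),x_0-y\rangle+\langle F(x_0,U(x_0)),U(x_0)-V\rangle .$$ *)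

theory Defs
  imports "HOL-Analysis.Analysis"
begin

definition orthant :: "(real ^ 'd) set" where
  "orthant = {x. \<forall>i. 0 \<le> x $ i}"

text \<open>Only used on the orthant, where it is the 1-norm.\<close>

definition sum1 :: "real ^ 'd \<Rightarrow> real" where
  "sum1 x = (\<Sum>i\<in>UNIV. x $ i)"

definition ball1 :: "real \<Rightarrow> (real ^ 'd) set" where
  "ball1 R = {x \<in> orthant. sum1 x \<le> R}"

definition strict_min_on :: "('a \<Rightarrow> real) \<Rightarrow> 'a set \<Rightarrow> 'a \<Rightarrow> bool" where
  "strict_min_on f S x0 \<longleftrightarrow> x0 \<in> S \<and> (\<forall>x\<in>S. x \<noteq> x0 \<longrightarrow> f x0 < f x)"

text \<open>The order on \<open>real ^ 'd\<close> is componentwise. Functions on the orthant are total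
  functions of which only the values on \<open>orthant\<close> matter.\<close>

definition monotone_solution ::
  "(real ^ 'd \<Rightarrow> real ^ 'd \<Rightarrow> real ^ 'd) \<Rightarrow> (real ^ 'd \<Rightarrow> real ^ 'd \<Rightarrow> real ^ 'd) \<Rightarrow>
   real \<Rightarrow> real \<Rightarrow> (real ^ 'd \<Rightarrow> real ^ 'd) \<Rightarrow> (real ^ 'd \<Rightarrow> real ^ 'd) \<Rightarrow> bool" where
  "monotone_solution F G r l T U \<longleftrightarrow>
     continuous_on orthant U \<and>
     (\<forall>x\<in>orthant. U x \<le> 0) \<and>
     (\<exists>R0>0. \<forall>V y R x0.
        V \<le> 0 \<longrightarrow> y \<in> orthant \<longrightarrow> R \<ge> R0 \<longrightarrow>
        strict_min_on (\<lambda>x. (U x - V) \<bullet> (x - y)) (ball1 R) x0 \<longrightarrow>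
        r * (U x0 \<bullet> (x0 - y)) + l * ((U x0 - adjoint T (U (T x0))) \<bullet> (x0 - y))
          \<ge> G x0 (U x0) \<bullet> (x0 - y) + F x0 (U x0) \<bullet> (U x0 - V))"

definition monotone_pair ::
  "(real ^ 'd \<Rightarrow> real ^ 'd \<Rightarrow> real ^ 'd) \<Rightarrow> (real ^ 'd \<Rightarrow> real ^ 'd \<Rightarrow> real ^ 'd) \<Rightarrow> bool" where
  "monotone_pair G F \<longleftrightarrow>
     (\<forall>x\<in>orthant. \<forall>y\<in>orthant. \<forall>p q.
        (G x p - G y q) \<bullet> (x - y) + (F x p - F y q) \<bullet> (p - q) \<ge> 0)"

end

theory Submission
  imports Defs
begin

text \<open>
  Let \<open>U\<^sub>1\<close>, \<open>U\<^sub>2\<close> be two monotone solutions and \<open>W(x,y) = \<langle>U\<^sub>1(x) - U\<^sub>2(y), x - y\<rangle>\<close>. Once \<open>W \<ge> 0\<close> on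
  the orthant, taking \<open>y = x + t e\<^sub>i\<close> and \<open>t \<rightarrow> 0+\<close> gives \<open>U\<^sub>1 \<le> U\<^sub>2\<close> componentwise, and equality by
  symmetry.

  For \<open>W \<ge> 0\<close>, put \<open>e = (R,\<dots>,R)\<close> and minimise the concavely perturbed function
  \<open>W(x,y) - \<delta>|x - e|\<^sup>2 - \<delta>|y - e|\<^sup>2\<close> over \<open>B\<^sub>R \<times> B\<^sub>R\<close>. At a minimiser \<open>(x\<^sub>0,y\<^sub>0)\<close>, linearising the
  perturbation makes \<open>x\<^sub>0\<close> a \<^emph>\<open>strict\<close> minimum of \<open>x \<mapsto> \<langle>U\<^sub>1(x) - (U\<^sub>2(y\<^sub>0) - a), x - y\<^sub>0\<rangle>\<close> with
  \<open>a = 2\<delta>(e - x\<^sub>0) \<ge> 0\<close>, so \<open>U\<^sub>2(y\<^sub>0) - a \<le> 0\<close> is an admissible \<open>V\<close>; likewise for \<open>y\<^sub>0\<close>. Adding the two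
  inequalities of the definition, monotonicity of \<open>(G,F)\<close> leaves
  \<open>r W(x\<^sub>0,y\<^sub>0) + \<lambda>(W(x\<^sub>0,y\<^sub>0) - W(Tx\<^sub>0,Ty\<^sub>0)) \<ge> \<langle>F(x\<^sub>0,U\<^sub>1(x\<^sub>0)),a\<rangle> + \<langle>F(y\<^sub>0,U\<^sub>2(y\<^sub>0)),b\<rangle>\<close>.
  As \<open>T\<close> preserves \<open>B\<^sub>R\<close>, everything is \<open>O(\<delta>)\<close> except \<open>r W\<close>, whence \<open>W \<ge> 0\<close>. No continuity of \<open>F\<close>
  is available to bound the right-hand side; the bound comes from monotonicity.
\<close>

section \<open>A lower bound for \<open>F\<close> from monotonicity\<close>

text \<open>
  For fixed \<open>(x,p)\<close> monotonicity against the finitely many pairs of vertices gives a lower bound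
  that is affine in the second pair, hence it extends to the convex hulls; there the choice \<open>v = x\<close>
  eliminates the possibly unbounded \<open>G x p\<close>.
\<close>

lemma monotone_on_polytopes_bounded:
  fixes S Q :: "'a::euclidean_space set" and F G :: "'a \<Rightarrow> 'a \<Rightarrow> 'a"
  assumes "polytope S" "polytope Q"
    and mono: "\<And>x y p q. \<lbrakk>x \<in> S; y \<in> S; p \<in> Q; q \<in> Q\<rbrakk> \<Longrightarrow>
      (G x p - G y q) \<bullet> (x - y) + (F x p - F y q) \<bullet> (p - q) \<ge> 0"
  obtains C where "\<And>x p q. \<lbrakk>x \<in> S; p \<in> Q; q \<in> Q\<rbrakk> \<Longrightarrow> F x p \<bullet> (p - q) \<ge> - C"
proof -
  obtain V P where V: "finite V" "S = convex hull V" and P: "finite P" "Q = convex hull P"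
    using assms(1,2) unfolding polytope_def by auto
  have "bounded (S \<union> Q)"
    using assms(1,2) by (simp add: polytope_imp_bounded)
  then obtain D where "D > 0" and D: "\<And>x. x \<in> S \<union> Q \<Longrightarrow> norm x \<le> D"
    unfolding bounded_pos by auto
  define c where "c = (\<lambda>(v, q). (norm (G v q) + norm (F v q)) * (2 * D))"
  define C where "C = sum c (V \<times> P)"
  have "F x p \<bullet> (p - q) \<ge> - C" if x: "x \<in> S" and p: "p \<in> Q" and q: "q \<in> Q" for x p q
  proof -
    have vertices: "G x p \<bullet> (x - v) + F x p \<bullet> (p - q) \<ge> - C" if v: "v \<in> V" and q: "q \<in> P" for v q
    proof -
      have vS: "v \<in> S" and qQ: "q \<in> Q"
        using v q V P hull_inc by metis+
      have 1: "norm (x - v) \<le> 2 * D" "norm (p - q) \<le> 2 * D"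
        using norm_triangle_ineq4[of x v] norm_triangle_ineq4[of p q]
          D[of x] D[of v] D[of p] D[of q] x p vS qQ by auto
      have "\<bar>G v q \<bullet> (x - v)\<bar> \<le> norm (G v q) * (2 * D)"
        by (rule order_trans[OF Cauchy_Schwarz_ineq2]) (simp add: 1 mult_left_mono)
      moreover have "\<bar>F v q \<bullet> (p - q)\<bar> \<le> norm (F v q) * (2 * D)"
        by (rule order_trans[OF Cauchy_Schwarz_ineq2]) (simp add: 1 mult_left_mono)
      moreover have "c (v, q) \<le> C"
        unfolding C_def using V P v q \<open>D > 0\<close>
        by (intro member_le_sum) (auto simp: c_def)
      ultimately show ?thesis
        using mono[OF x vS p qQ] by (simp add: c_def inner_diff_left algebra_simps)
    qed
    have "F x p \<bullet> (p - q) \<ge> - C" if q: "q \<in> P" for q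
    proof -
      have "V \<subseteq> {v. G x p \<bullet> v \<le> G x p \<bullet> x + F x p \<bullet> (p - q) + C}"
        using vertices[OF _ q] by (fastforce simp: inner_diff_right)
      then have "S \<subseteq> {v. G x p \<bullet> v \<le> G x p \<bullet> x + F x p \<bullet> (p - q) + C}"
        unfolding V(2) by (rule hull_minimal) (rule convex_halfspace_le)
      then show ?thesis
        using x by auto
    qed
    then have "P \<subseteq> {q. F x p \<bullet> q \<le> F x p \<bullet> p + C}"
      by (fastforce simp: inner_diff_right)
    then have "Q \<subseteq> {q. F x p \<bullet> q \<le> F x p \<bullet> p + C}"
      unfolding P(2) by (rule hull_minimal) (rule convex_halfspace_le)
    then show ?thesis
      using q by (auto simp: inner_diff_right)
  qed
  then show ?thesis
    using that by blast
qed

section \<open>Geometry of the truncated orthant\<close>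

lemma ball1_subset_orthant: "ball1 R \<subseteq> orthant"
  by (auto simp: ball1_def)

lemma ball1_le:
  assumes "x \<in> ball1 R"
  shows "0 \<le> x $ i" "x $ i \<le> R"
proof -
  have "x $ i \<le> sum1 x" unfolding sum1_def
    using assms by (intro member_le_sum) (auto simp: ball1_def orthant_def)
  then show "0 \<le> x $ i" "x $ i \<le> R"
    using assms by (auto simp: ball1_def orthant_def)
qed

lemma ball1_subset_cbox: "ball1 R \<subseteq> cbox 0 (\<chi> i. R)"
  by (auto simp: mem_box_cart ball1_le)

lemma compact_ball1: "compact (ball1 R :: (real ^ 'd) set)"
proof -
  have "closed (\<Inter>i. {x::real^'d. 0 \<le> x $ i})" "closed {x::real^'d. sum1 x \<le> R}"
    unfolding sum1_def by (intro closed_INT ballI closed_Collect_le continuous_intros)+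
  moreover have "ball1 R = (\<Inter>i. {x::real^'d. 0 \<le> x $ i}) \<inter> {x. sum1 x \<le> R}"
    by (auto simp: ball1_def orthant_def)
  ultimately have "closed (ball1 R :: (real^'d) set)"
    by (simp only: closed_Int)
  moreover have "bounded (ball1 R :: (real^'d) set)"
    using bounded_subset[OF bounded_cbox ball1_subset_cbox] .
  ultimately show ?thesis
    by (simp add: compact_eq_bounded_closed)
qed

lemma scaleR_mem_ball1:
  assumes "x \<in> ball1 R" "c \<ge> 0"
  shows "c *\<^sub>R x \<in> ball1 (c * R)"
  using assms by (auto simp: ball1_def orthant_def sum1_def mult_left_mono simp flip: sum_distrib_left)

text \<open>\<open>ball1 R\<close> is a dilate of \<open>ball1 S\<close> and \<open>T\<close>
  commutes with scaling. So the radius can be enlarged at will without losing invariance.\<close>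

lemma linear_maps_ball1:
  assumes "linear T" "T ` ball1 S \<subseteq> ball1 S" "S > 0" "R > 0"
  shows "T ` ball1 R \<subseteq> ball1 R"
proof
  fix y assume "y \<in> T ` ball1 R"
  then obtain x where x: "x \<in> ball1 R" and y: "y = T x" by auto
  have "(S / R) *\<^sub>R x \<in> ball1 S"
    using scaleR_mem_ball1[OF x, of "S / R"] assms by simp
  then have "(S / R) *\<^sub>R y \<in> ball1 S"
    using assms(1,2) by (auto simp: y simp flip: linear_scale)
  from scaleR_mem_ball1[OF this, of "R / S"] show "y \<in> ball1 R"
    using assms by simp
qed

section \<open>Strict minima from a quadratic perturbation\<close>

lemma monotone_solutionD:
  assumes "monotone_solution F G r l T U"
  shows "continuous_on orthant U" "\<And>x. x \<in> orthant \<Longrightarrow> U x \<le> 0"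
  using assms unfolding monotone_solution_def by auto

lemma monotone_solution_inequality:
  assumes "monotone_solution F G r l T U"
  obtains R0 where "R0 > 0" "\<And>V y R x0. \<lbrakk>V \<le> 0; y \<in> orthant; R \<ge> R0;
        strict_min_on (\<lambda>x. (U x - V) \<bullet> (x - y)) (ball1 R) x0\<rbrakk> \<Longrightarrow>
        r * (U x0 \<bullet> (x0 - y)) + l * ((U x0 - adjoint T (U (T x0))) \<bullet> (x0 - y))
          \<ge> G x0 (U x0) \<bullet> (x0 - y) + F x0 (U x0) \<bullet> (U x0 - V)"
  using assms unfolding monotone_solution_def by auto

lemma strict_min_on_linearized:
  fixes U :: "real ^ 'd \<Rightarrow> real ^ 'd"
  assumes x0: "x0 \<in> S" and "\<delta> > 0"
    and min: "\<And>x. x \<in> S \<Longrightarrow> (U x0 - V) \<bullet> (x0 - y) - \<delta> * (norm (x0 - e))\<^sup>2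
      \<le> (U x - V) \<bullet> (x - y) - \<delta> * (norm (x - e))\<^sup>2"
  shows "strict_min_on (\<lambda>x. (U x - (V - (2 * \<delta>) *\<^sub>R (e - x0))) \<bullet> (x - y)) S x0"
  unfolding strict_min_on_def
proof (intro conjI ballI impI x0)
  fix x assume x: "x \<in> S" and "x \<noteq> x0"
  then have pos: "0 < \<delta> * (norm (x - x0))\<^sup>2"
    using \<open>\<delta> > 0\<close> by simp
  \<comment> \<open>Expansion about \<open>x0\<close>, with the linear term based at
    \<open>y\<close> so that it merges into the product with \<open>x - y\<close>. The remaining
    square, positive off \<open>x0\<close>, makes the minimum strict.\<close>
  have eq: "(norm (x - e))\<^sup>2 = (norm (x - x0))\<^sup>2 - 2 * ((e - x0) \<bullet> (x - y)) + 2 * ((e - x0) \<bullet> (x0 - y))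
      + (norm (x0 - e))\<^sup>2"
    by (simp add: power2_norm_eq_inner inner_diff_left inner_diff_right inner_commute)
  have "\<delta> * (norm (x - e))\<^sup>2 = \<delta> * (norm (x - x0))\<^sup>2 - (2 * \<delta>) * ((e - x0) \<bullet> (x - y))
      + (2 * \<delta>) * ((e - x0) \<bullet> (x0 - y)) + \<delta> * (norm (x0 - e))\<^sup>2"
    unfolding eq by (simp add: algebra_simps)
  moreover have split: "(U z - (V - (2 * \<delta>) *\<^sub>R (e - x0))) \<bullet> (z - y) =
      (U z - V) \<bullet> (z - y) + (2 * \<delta>) * ((e - x0) \<bullet> (z - y))" for z
    by (simp add: inner_add_left inner_diff_left algebra_simps)
  ultimately show "(U x0 - (V - (2 * \<delta>) *\<^sub>R (e - x0))) \<bullet> (x0 - y)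
      < (U x - (V - (2 * \<delta>) *\<^sub>R (e - x0))) \<bullet> (x - y)"
    unfolding split using min[OF x] pos by linarith
qed

lemma nonneg_if_perturbed_nonneg:
  fixes w K :: real
  assumes "\<And>\<delta>. \<delta> > 0 \<Longrightarrow> 0 \<le> w + \<delta> * K"
  shows "0 \<le> w"
proof (rule tendsto_lowerbound)
  show "((\<lambda>\<delta>. w + \<delta> * K) \<longlongrightarrow> w) (at_right 0)"
    by (auto intro!: tendsto_eq_intros)
  show "\<forall>\<^sub>F \<delta> in at_right 0. 0 \<le> w + \<delta> * K"
    using assms by (simp add: eventually_at_right_less eventually_at_filter)
qed simp

section \<open>Cross-monotonicity of two solutions\<close>

lemma monotone_solutions_cross_monotone:
  fixes F G :: "real ^ 'd \<Rightarrow> real ^ 'd \<Rightarrow> real ^ 'd"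
  assumes r: "r > 0" and l: "l > 0" and T: "linear T"
    and S: "S > 0" "T ` ball1 S \<subseteq> ball1 S"
    and GF: "monotone_pair G F"
    and U1: "monotone_solution F G r l T U1" and U2: "monotone_solution F G r l T U2"
    and x: "x \<in> orthant" and y: "y \<in> orthant"
  shows "(U1 x - U2 y) \<bullet> (x - y) \<ge> 0"
proof -
  obtain R1 where "R1 > 0" and R1: "\<And>V y R x0. \<lbrakk>V \<le> 0; y \<in> orthant; R \<ge> R1;
        strict_min_on (\<lambda>x. (U1 x - V) \<bullet> (x - y)) (ball1 R) x0\<rbrakk> \<Longrightarrow>
        r * (U1 x0 \<bullet> (x0 - y)) + l * ((U1 x0 - adjoint T (U1 (T x0))) \<bullet> (x0 - y))
          \<ge> G x0 (U1 x0) \<bullet> (x0 - y) + F x0 (U1 x0) \<bullet> (U1 x0 - V)"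
    by (rule monotone_solution_inequality[OF U1]) (rule that)
  obtain R2 where "R2 > 0" and R2: "\<And>V y R x0. \<lbrakk>V \<le> 0; y \<in> orthant; R \<ge> R2;
        strict_min_on (\<lambda>x. (U2 x - V) \<bullet> (x - y)) (ball1 R) x0\<rbrakk> \<Longrightarrow>
        r * (U2 x0 \<bullet> (x0 - y)) + l * ((U2 x0 - adjoint T (U2 (T x0))) \<bullet> (x0 - y))
          \<ge> G x0 (U2 x0) \<bullet> (x0 - y) + F x0 (U2 x0) \<bullet> (U2 x0 - V)"
    by (rule monotone_solution_inequality[OF U2]) (rule that)
  define R where "R = Max {R1, R2, sum1 x, sum1 y}"
  have R: "R \<ge> R1" "R \<ge> R2" "R > 0" and xB: "x \<in> ball1 R" and yB: "y \<in> ball1 R"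
    using x y \<open>R1 > 0\<close> by (auto simp: R_def ball1_def)
  define B :: "(real ^ 'd) set" where "B = ball1 R"
  define e :: "real ^ 'd" where "e = (\<chi> i. R)"
  have B: "compact B" "B \<subseteq> orthant" "B \<subseteq> cbox 0 e"
    unfolding B_def e_def by (simp_all add: compact_ball1 ball1_subset_orthant ball1_subset_cbox)
  have box: "cbox 0 e \<subseteq> orthant"
    by (auto simp: mem_box_cart orthant_def)
  have TB: "T z \<in> B" if "z \<in> B" for z
    using linear_maps_ball1[OF T S(2,1) R(3)] that unfolding B_def by auto
  have cont: "continuous_on B U1" "continuous_on B U2"
    using monotone_solutionD(1)[OF U1] monotone_solutionD(1)[OF U2] B(2) by (auto intro: continuous_on_subset)

  \<comment> \<open>All second arguments needed for the bound on \<open>F\<close>: with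
    \<open>p = U1 z\<close> and \<open>q = U1 z - 2 *\<^sub>R (e - z)\<close>, the difference
    \<open>p - q\<close> is the shift \<open>a\<close> without its factor \<delta>. Hence
    \<open>C\<close> does not depend on \<delta>.\<close>
  let ?A = "U1 ` B \<union> U2 ` B \<union> (\<lambda>z. U1 z - 2 *\<^sub>R (e - z)) ` B \<union> (\<lambda>z. U2 z - 2 *\<^sub>R (e - z)) ` B"
  have "bounded ?A"
    by (intro compact_imp_bounded compact_Un compact_continuous_image continuous_intros cont B)
  then obtain M where M: "?A \<subseteq> cbox (- M) M"
    by (rule bounded_subset_cbox_symmetric)
  obtain C where C: "\<And>x p q. \<lbrakk>x \<in> cbox 0 e; p \<in> cbox (- M) M; q \<in> cbox (- M) M\<rbrakk> \<Longrightarrow>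
      F x p \<bullet> (p - q) \<ge> - C"
  proof (rule monotone_on_polytopes_bounded[of "cbox 0 e" "cbox (- M) M" G F])
    show "(G x p - G y q) \<bullet> (x - y) + (F x p - F y q) \<bullet> (p - q) \<ge> 0"
      if "x \<in> cbox 0 e" "y \<in> cbox 0 e" for x y p q
      using GF box that unfolding monotone_pair_def by blast
  qed (use that in \<open>auto simp: polytope_interval\<close>)
  have F1: "F z (U1 z) \<bullet> (2 *\<^sub>R (e - z)) \<ge> - C" if "z \<in> B" for z
    using C[of z "U1 z" "U1 z - 2 *\<^sub>R (e - z)"] M subsetD[OF B(3) that] that
    by (simp add: image_subset_iff)
  have F2: "F z (U2 z) \<bullet> (2 *\<^sub>R (e - z)) \<ge> - C" if "z \<in> B" for z
    using C[of z "U2 z" "U2 z - 2 *\<^sub>R (e - z)"] M subsetD[OF B(3) that] that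
    by (simp add: image_subset_iff)

  define W where "W = (\<lambda>x y. (U1 x - U2 y) \<bullet> (x - y))"
  define N where "N = (\<lambda>x y. (norm (x - e))\<^sup>2 + (norm (y - e))\<^sup>2)"
  have contWN: "continuous_on (B \<times> B) (\<lambda>z. W (fst z) (snd z))"
    "continuous_on (B \<times> B) (\<lambda>z. N (fst z) (snd z))"
    unfolding W_def N_def
    by (intro continuous_intros continuous_on_compose2[OF cont(1)] continuous_on_compose2[OF cont(2)];
        force)+
  have ne: "B \<times> B \<noteq> {}"
    using xB by (auto simp: B_def)
  obtain D where D: "\<And>x y. x \<in> B \<Longrightarrow> y \<in> B \<Longrightarrow> N x y \<le> D"
    using continuous_attains_sup[OF compact_Times[OF B(1) B(1)] ne contWN(2)] by fastforce
  have N0: "N x y \<ge> 0" for x y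
    by (simp add: N_def)

  \<comment> \<open>\<open>D\<close> and \<open>C\<close> were fixed before \<delta>, so the error
    term vanishes as \<delta> tends to 0.\<close>
  have "0 \<le> r * W x y + \<delta> * ((r + l) * D + 2 * C)" if \<delta>: "\<delta> > 0" for \<delta>
  proof -
    have "continuous_on (B \<times> B) (\<lambda>z. W (fst z) (snd z) - \<delta> * N (fst z) (snd z))"
      by (intro continuous_intros contWN)
    from continuous_attains_inf[OF compact_Times[OF B(1) B(1)] ne this]
    obtain x0 y0 where x0: "x0 \<in> B" and y0: "y0 \<in> B"
      and min: "\<And>x y. x \<in> B \<Longrightarrow> y \<in> B \<Longrightarrow> W x0 y0 - \<delta> * N x0 y0 \<le> W x y - \<delta> * N x y"
      by fastforce
    define a b where "a = (2 * \<delta>) *\<^sub>R (e - x0)" and "b = (2 * \<delta>) *\<^sub>R (e - y0)"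
    have orth: "x0 \<in> orthant" "y0 \<in> orthant"
      using x0 y0 B by auto
    \<comment> \<open>The corner \<open>e\<close> dominates every point of \<open>B\<close>
      componentwise; this is why the perturbation is centred there.\<close>
    have ab: "a \<ge> 0" "b \<ge> 0"
      using x0 y0 \<delta> unfolding a_def b_def e_def B_def by (auto simp: less_eq_vec_def ball1_le)
    have V: "U2 y0 - a \<le> 0" "U1 x0 - b \<le> 0"
      using monotone_solutionD(2)[OF U2 orth(2)] monotone_solutionD(2)[OF U1 orth(1)] ab
      by (meson diff_le_0_iff_le order_trans)+
    have "strict_min_on (\<lambda>x. (U1 x - (U2 y0 - a)) \<bullet> (x - y0)) (ball1 R) x0"
      unfolding a_def
    proof (rule strict_min_on_linearized[OF x0[unfolded B_def] \<delta>])
      fix x :: "real ^ 'd" assume "x \<in> ball1 R"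
      then show "(U1 x0 - U2 y0) \<bullet> (x0 - y0) - \<delta> * (norm (x0 - e))\<^sup>2
          \<le> (U1 x - U2 y0) \<bullet> (x - y0) - \<delta> * (norm (x - e))\<^sup>2"
        using min[of x y0] y0 by (simp add: W_def N_def B_def algebra_simps)
    qed
    from R1[OF V(1) orth(2) R(1) this]
    have 1: "r * (U1 x0 \<bullet> (x0 - y0)) + l * ((U1 x0 - adjoint T (U1 (T x0))) \<bullet> (x0 - y0))
        \<ge> G x0 (U1 x0) \<bullet> (x0 - y0) + F x0 (U1 x0) \<bullet> (U1 x0 - (U2 y0 - a))" .
    have "strict_min_on (\<lambda>y. (U2 y - (U1 x0 - b)) \<bullet> (y - x0)) (ball1 R) y0"
      unfolding b_def
    proof (rule strict_min_on_linearized[OF y0[unfolded B_def] \<delta>])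
      fix y :: "real ^ 'd" assume "y \<in> ball1 R"
      moreover have "(U2 y - U1 x0) \<bullet> (y - x0) = W x0 y" for y
        by (simp add: W_def inner_diff_left inner_diff_right)
      ultimately show "(U2 y0 - U1 x0) \<bullet> (y0 - x0) - \<delta> * (norm (y0 - e))\<^sup>2
          \<le> (U2 y - U1 x0) \<bullet> (y - x0) - \<delta> * (norm (y - e))\<^sup>2"
        using min[of x0 y] x0 by (simp add: N_def B_def algebra_simps)
    qed
    from R2[OF V(2) orth(1) R(2) this]
    have 2: "r * (U2 y0 \<bullet> (y0 - x0)) + l * ((U2 y0 - adjoint T (U2 (T y0))) \<bullet> (y0 - x0))
        \<ge> G y0 (U2 y0) \<bullet> (y0 - x0) + F y0 (U2 y0) \<bullet> (U2 y0 - (U1 x0 - b))" .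
    have 3: "(G x0 (U1 x0) - G y0 (U2 y0)) \<bullet> (x0 - y0)
        + (F x0 (U1 x0) - F y0 (U2 y0)) \<bullet> (U1 x0 - U2 y0) \<ge> 0"
      using GF orth unfolding monotone_pair_def by blast
    have "F x0 (U1 x0) \<bullet> a = \<delta> * (F x0 (U1 x0) \<bullet> (2 *\<^sub>R (e - x0)))"
      "F y0 (U2 y0) \<bullet> b = \<delta> * (F y0 (U2 y0) \<bullet> (2 *\<^sub>R (e - y0)))"
      by (simp_all add: a_def b_def)
    then have 4: "F x0 (U1 x0) \<bullet> a \<ge> \<delta> * (- C)" "F y0 (U2 y0) \<bullet> b \<ge> \<delta> * (- C)"
      using F1[OF x0] F2[OF y0] \<delta> by (metis mult_left_mono less_imp_le)+
    have adj: "adjoint T u \<bullet> z = u \<bullet> T z" for u z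
      using adjoint_works[OF T, of z u] by (simp add: inner_commute)
    have WT: "W (T x0) (T y0) = U1 (T x0) \<bullet> (T x0 - T y0) - U2 (T y0) \<bullet> (T x0 - T y0)"
      by (simp add: W_def inner_diff_left)
    have Wr: "r * (U1 x0 \<bullet> (x0 - y0)) + r * (U2 y0 \<bullet> (y0 - x0)) = r * W x0 y0"
      by (simp add: W_def inner_diff_left inner_diff_right algebra_simps)
    have Wl: "l * ((U1 x0 - adjoint T (U1 (T x0))) \<bullet> (x0 - y0))
        + l * ((U2 y0 - adjoint T (U2 (T y0))) \<bullet> (y0 - x0)) = l * (W x0 y0 - W (T x0) (T y0))"
      unfolding inner_diff_left adj linear_diff[OF T] WT
      by (simp add: W_def inner_diff_left inner_diff_right algebra_simps)
    have GFsum: "G x0 (U1 x0) \<bullet> (x0 - y0) + F x0 (U1 x0) \<bullet> (U1 x0 - (U2 y0 - a))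
        + (G y0 (U2 y0) \<bullet> (y0 - x0) + F y0 (U2 y0) \<bullet> (U2 y0 - (U1 x0 - b)))
      = (G x0 (U1 x0) - G y0 (U2 y0)) \<bullet> (x0 - y0)
        + (F x0 (U1 x0) - F y0 (U2 y0)) \<bullet> (U1 x0 - U2 y0) + F x0 (U1 x0) \<bullet> a + F y0 (U2 y0) \<bullet> b"
      by (simp add: inner_diff_left inner_diff_right inner_add_right algebra_simps)
    have sum: "r * W x0 y0 + l * (W x0 y0 - W (T x0) (T y0)) \<ge> - 2 * (\<delta> * C)"
      using 1 2 3 4 Wr Wl GFsum by linarith
    have ND: "\<delta> * N x0 y0 \<le> \<delta> * D" "0 \<le> \<delta> * N x y" "0 \<le> \<delta> * N (T x0) (T y0)"
      using D[OF x0 y0] \<delta> N0 by auto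
    have "W x0 y0 \<le> W x y + \<delta> * D"
      using min[of x y] xB yB ND unfolding B_def by linarith
    \<comment> \<open>The image pair under \<open>T\<close> is a competitor in the minimisation, so
      the jump term costs at most a multiple of \<delta>.\<close>
    moreover have "W x0 y0 - W (T x0) (T y0) \<le> \<delta> * D"
      using min[OF TB[OF x0] TB[OF y0]] ND by linarith
    ultimately have "r * W x0 y0 \<le> r * (W x y + \<delta> * D)"
        "l * (W x0 y0 - W (T x0) (T y0)) \<le> l * (\<delta> * D)"
      using r l by auto
    with sum show ?thesis
      by (simp add: algebra_simps)
  qed
  then have "0 \<le> r * W x y"
    by (rule nonneg_if_perturbed_nonneg)
  then show ?thesis
    using r by (simp add: W_def zero_le_mult_iff)
qed

section \<open>From cross-monotonicity to uniqueness\<close>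

lemma cross_monotone_imp_le:
  fixes U V :: "real ^ 'd \<Rightarrow> real ^ 'd"
  assumes "continuous_on orthant V"
    and cross: "\<And>x y. \<lbrakk>x \<in> orthant; y \<in> orthant\<rbrakk> \<Longrightarrow> (U x - V y) \<bullet> (x - y) \<ge> 0"
    and x: "x \<in> orthant"
  shows "U x \<le> V x"
  unfolding less_eq_vec_def
proof
  fix i
  define y where "y = (\<lambda>t. x + t *\<^sub>R axis i (1::real))"
  have y: "y t \<in> orthant" if "t \<ge> 0" for t
    using x that by (auto simp: y_def orthant_def axis_def)
  have le: "U x $ i \<le> V (y t) $ i" if "t > 0" for t
  proof -
    have "x - y t = - t *\<^sub>R axis i 1"
      by (simp add: y_def)
    then have "0 \<le> - t * ((U x - V (y t)) \<bullet> axis i 1)"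
      using cross[OF x y[of t]] that by simp
    then show ?thesis
      using that by (simp add: inner_axis mult_le_0_iff)
  qed
  \<comment> \<open>\<open>V\<close> is continuous only on the orthant, which is known to contain
    \<open>y t\<close> for \<open>t \<ge> 0\<close>; hence the one-sided limit.\<close>
  have "continuous_on {0..} (\<lambda>t. V (y t) $ i)"
    unfolding y_def
    by (intro continuous_intros continuous_on_compose2[OF assms(1)]) (use y in \<open>auto simp: y_def\<close>)
  then have "((\<lambda>t. V (y t) $ i) \<longlongrightarrow> V (y 0) $ i) (at 0 within {0..})"
    by (simp add: continuous_on)
  then have "((\<lambda>t. V (y t) $ i) \<longlongrightarrow> V x $ i) (at_right 0)"
    by (auto simp: y_def intro: tendsto_within_subset)
  then show "U x $ i \<le> V x $ i"
    by (rule tendsto_lowerbound) (auto simp: eventually_at_filter le)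
qed

theorem theorem3p2:
  fixes F G :: "real ^ 'd \<Rightarrow> real ^ 'd \<Rightarrow> real ^ 'd"
    and r l :: real
    and T :: "real ^ 'd \<Rightarrow> real ^ 'd"
  assumes "CARD('d) > 1"
    and "r > 0" and "l > 0"
    and "linear T"
    and "\<And>x p i. x \<in> orthant \<Longrightarrow> x $ i = 0 \<Longrightarrow> F x p $ i \<le> 0"
    and "T ` orthant \<subseteq> orthant"
    and "\<exists>Rs>0. (\<forall>x\<in>orthant. \<forall>p. sum1 x \<ge> Rs \<longrightarrow> (\<Sum>i\<in>UNIV. F x p $ i) \<ge> 0)
                 \<and> T ` ball1 Rs \<subseteq> ball1 Rs"
    and "monotone_pair G F"
  shows "\<forall>U1 U2. monotone_solution F G r l T U1 \<and> monotone_solution F G r l T U2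
           \<longrightarrow> (\<forall>x\<in>orthant. U1 x = U2 x)"
proof (intro allI impI ballI)
  fix U1 U2 :: "real ^ 'd \<Rightarrow> real ^ 'd" and x :: "real ^ 'd"
  assume "monotone_solution F G r l T U1 \<and> monotone_solution F G r l T U2"
  then have U: "monotone_solution F G r l T U1" "monotone_solution F G r l T U2"
    by auto
  assume x: "x \<in> orthant"
  obtain S where S: "S > 0" "T ` ball1 S \<subseteq> ball1 S"
    using assms(7) by auto
  note cross = monotone_solutions_cross_monotone[OF assms(2,3,4) S assms(8)]
  show "U1 x = U2 x"
  proof (rule antisym)
    show "U1 x \<le> U2 x"
      using cross_monotone_imp_le[OF monotone_solutionD(1)[OF U(2)] cross[OF U] x] .
    show "U2 x \<le> U1 x"
      using cross_monotone_imp_le[OF monotone_solutionD(1)[OF U(1)] cross[OF U(2,1)] x] .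
  qed
qed

end
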